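(* Let $(v_1,\ldots,v_p)$ and $(w_1,\ldots,w_p)$ be bases of $p$-dimensional subspaces $V$ and $W$ of $X$, respectively, and let $A=\big(\langle w_i,w_j\rangle\big)$, $B=\big(\langle w_i,v_j\rangle\big)$ and $D=\big(\langle v_i,v_j\rangle\big)$ (all $p\times p$ matrices). Then $$\cos^2 \Theta_{V,W} = \frac{|\det B|^2}{\det A \cdot\det D}.$$
   Context: $X$ is an $n$-dimensional vector space over $\mathbb{R}$ (real case) or $\mathbb{C}$ (complex case) with inner product $\langle\cdot,\cdot\rangle$ (Hermitian in the complex case, conjugate-linear in the first argument). Blades: a $p$-blade is a simple multivector $\nu=v_1\wedge\cdots\wedge v_p\in\Lambda^pX$; if $\nu\neq0$ it represents the $p$-dimensional subspace $V=\mathrm{span}(v_1,\ldots,v_p)$. Nonzero scalars in $\Lambda^0X$ are $0$-blades representing $\{0\}$. $\Lambda X$ has the inner product given on $p$-blades by $\langle v_1\wedge\cdots\wedge v_p,\,w_1\wedge\cdots\wedge w_p\rangle=\det(\langle v_i,w_j\rangle)$, extended (sesqui)linearly, with distinct grades orthogonal; $\|\nu\|=\sqrt{\langle\nu,\nu\rangle}$. Grassmann angle: for subspaces $V,W\subset X$, let $P$ be the orthogonal projection of $X$ onto $W$, acting on blades by $P(v_1\wedge\cdots\wedge v_p)=Pv_1\wedge\cdots\wedge Pv_p$ (identity on scalars). The Grassmann angle $\Theta_{V,W}\in[0,\frac\pi2]$ is defined by $\cos\Theta_{V,W}=\|P\nu\|/\|\nu\|$ for any nonzero blade $\nu$ representing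 $V$ (independent of $\nu$). *)

theory Defs
  imports Complex_Main "Jordan_Normal_Form.Determinant" "Jordan_Normal_Form.Conjugate"
begin

text \<open>Scalars: the axiom below determines the conjugation, so that it is the identity on the reals
  and the usual one on the complex numbers. A statement over this class covers the real and the
  complex case at once.\<close>

class rc_field = real_normed_field + conjugatable_field +
  assumes mult_conjugate: "a * conjugate a = scaleR ((norm a)\<^sup>2) 1"

instance real :: rc_field
  by intro_classes (simp add: power2_eq_square)

instance complex :: rc_field
  by intro_classes (simp add: complex_norm_square[symmetric] scaleR_conv_of_real)

text \<open>The inner product is conjugate-linear in the first and linear in the second argument. The
  set \<open>Basis\<close> only witnesses that the space has finite dimension \<open>card Basis\<close>; it need not be
  orthonormal, and no definition below depends on it.\<close>

locale fd_inner_product_space =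
  finite_dimensional_vector_space scale Basis
  for scale :: "'k::rc_field \<Rightarrow> 'x::ab_group_add \<Rightarrow> 'x" (infixr \<open>*s\<close> 75)
    and Basis :: "'x set" +
  fixes ip :: "'x \<Rightarrow> 'x \<Rightarrow> 'k"
  assumes ip_add_right: "ip x (y + z) = ip x y + ip x z"
    and ip_scale_right: "ip x (c *s y) = c * ip x y"
    and ip_commute: "ip y x = conjugate (ip x y)"
    and ip_pos: "x \<noteq> 0 \<Longrightarrow> \<exists>r>0. ip x x = of_real r"
begin

definition ordered_basis :: "'x list \<Rightarrow> 'x set \<Rightarrow> bool" where
  "ordered_basis vs V \<longleftrightarrow> distinct vs \<and> independent (set vs) \<and> span (set vs) = V"

definition proj :: "'x set \<Rightarrow> 'x \<Rightarrow> 'x" where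
  "proj W x = (THE y. y \<in> W \<and> (\<forall>w\<in>W. ip w (x - y) = 0))"

text \<open>As the space is finite-dimensional, its exterior algebra is canonically the space of
  alternating multilinear forms on the dual space, where the product of vectors
  \<open>v\<^sub>1 \<and> \<dots> \<and> v\<^sub>p\<close> is the form \<open>(\<phi>\<^sub>1, \<dots>, \<phi>\<^sub>p) \<mapsto> det (\<phi>\<^sub>i v\<^sub>j)\<close>. We represent
  multivectors as functions on lists of linear functionals: the restriction to lists of length
  \<open>p\<close> is the component of grade \<open>p\<close>, and values at lists with a non-linear entry are \<open>0\<close>.\<close>

definition functional :: "('x \<Rightarrow> 'k) \<Rightarrow> bool" where
  "functional \<phi> \<longleftrightarrow> Vector_Spaces.linear scale (*) \<phi>"

definition wedge :: "'x list \<Rightarrow> ('x \<Rightarrow> 'k) list \<Rightarrow> 'k" where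
  "wedge vs \<phi>s =
    (if length \<phi>s = length vs \<and> (\<forall>\<phi>\<in>set \<phi>s. functional \<phi>)
     then det (mat (length vs) (length vs) (\<lambda>(i, j). (\<phi>s ! i) (vs ! j))) else 0)"

text \<open>A blade is \<open>c v\<^sub>1 \<and> \<dots> \<and> v\<^sub>p\<close>. The scalar factor makes the \<open>0\<close>-blades the scalars
  (the empty product is \<open>1\<close>); for \<open>p > 0\<close> it could be absorbed into any one of the vectors.\<close>

definition represents :: "(('x \<Rightarrow> 'k) list \<Rightarrow> 'k) \<Rightarrow> 'x set \<Rightarrow> bool" where
  "represents \<nu> V \<longleftrightarrow>
    \<nu> \<noteq> (\<lambda>_. 0) \<and> (\<exists>c vs. \<nu> = (\<lambda>\<phi>s. c * wedge vs \<phi>s) \<and> V = span (set vs))"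

definition wedge_ip :: "'x list \<Rightarrow> 'x list \<Rightarrow> 'k" where
  "wedge_ip vs ws =
    (if length vs = length ws
     then det (mat (length vs) (length vs) (\<lambda>(i, j). ip (vs ! i) (ws ! j))) else 0)"

text \<open>Sesquilinear extension of \<open>wedge_ip\<close> to linear combinations of blades; by
  \<open>mv_inner_eq\<close> below it does not depend on the chosen combinations.\<close>

definition mv_inner :: "(('x \<Rightarrow> 'k) list \<Rightarrow> 'k) \<Rightarrow> (('x \<Rightarrow> 'k) list \<Rightarrow> 'k) \<Rightarrow> 'k" where
  "mv_inner F G = (THE z. \<exists>S a T b. finite S \<and> finite T \<and>
      F = (\<lambda>\<phi>s. \<Sum>vs\<in>S. a vs * wedge vs \<phi>s) \<and>
      G = (\<lambda>\<phi>s. \<Sum>ws\<in>T. b ws * wedge ws \<phi>s) \<and>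
      z = (\<Sum>vs\<in>S. \<Sum>ws\<in>T. conjugate (a vs) * b ws * wedge_ip vs ws))"

text \<open>The value \<open>mv_inner F F\<close> is a nonnegative real number lying in the scalar type; the inner
  \<open>norm\<close> only turns it into an element of \<^typ>\<open>real\<close>.\<close>

definition mv_norm :: "(('x \<Rightarrow> 'k) list \<Rightarrow> 'k) \<Rightarrow> real" where
  "mv_norm F = sqrt (norm (mv_inner F F))"

text \<open>The action of a linear map on multivectors, by precomposition of the functionals; see
  \<open>mv_map_wedge\<close> below.\<close>

definition mv_map :: "('x \<Rightarrow> 'x) \<Rightarrow> (('x \<Rightarrow> 'k) list \<Rightarrow> 'k) \<Rightarrow> (('x \<Rightarrow> 'k) list \<Rightarrow> 'k)" where
  "mv_map f F \<phi>s =
    (if \<forall>\<phi>\<in>set \<phi>s. functional \<phi> then F (map (\<lambda>\<phi>. \<phi> \<circ> f) \<phi>s) else 0)"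

definition grassmann_angle :: "'x set \<Rightarrow> 'x set \<Rightarrow> real" where
  "grassmann_angle V W = (THE \<theta>. 0 \<le> \<theta> \<and> \<theta> \<le> pi / 2 \<and>
    (\<forall>\<nu>. represents \<nu> V \<longrightarrow> cos \<theta> = mv_norm (mv_map (proj W) \<nu>) / mv_norm \<nu>))"

text \<open>Consistency of the definitions.\<close>

lemma functional_ip: "functional (ip x)"
  unfolding functional_def
  by (rule Vector_Spaces.linear_iff[THEN iffD2])
    (auto simp: vector_space_axioms ip_add_right ip_scale_right vector_space_def algebra_simps)

lemma functional_comp:
  assumes "functional \<phi>" "Vector_Spaces.linear scale scale f"
  shows "functional (\<phi> \<circ> f)"
  using assms unfolding functional_def by (metis Vector_Spaces.linear_compose)

lemma functional_sum:
  assumes "functional \<phi>"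
  shows "\<phi> (\<Sum>i\<in>I. c i *s v i) = (\<Sum>i\<in>I. c i * \<phi> (v i))"
proof -
  interpret Vector_Spaces.linear scale "(*)" \<phi>
    using assms by (simp add: functional_def)
  show ?thesis by (simp add: sum scale)
qed

lemma mv_map_wedge:
  assumes "Vector_Spaces.linear scale scale f"
  shows "mv_map f (\<lambda>\<phi>s. c * wedge vs \<phi>s) = (\<lambda>\<phi>s. c * wedge (map f vs) \<phi>s)"
proof
  fix \<phi>s :: "('x \<Rightarrow> 'k) list"
  have *: "functional (\<phi> \<circ> f)" if "functional \<phi>" for \<phi>
    using functional_comp[OF that assms] .
  have "mat (length vs) (length vs) (\<lambda>(i, j). (map (\<lambda>\<phi>. \<phi> \<circ> f) \<phi>s ! i) (vs ! j)) =
      mat (length vs) (length vs) (\<lambda>(i, j). (\<phi>s ! i) (map f vs ! j))"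
    if "length \<phi>s = length vs"
    by (rule eq_matI) (use that in auto)
  then show "mv_map f (\<lambda>\<phi>s. c * wedge vs \<phi>s) \<phi>s = c * wedge (map f vs) \<phi>s"
    using * by (auto simp: mv_map_def wedge_def)
qed

lemma wedge_ip_eq: "wedge_ip vs ws = wedge ws (map ip vs)"
proof -
  have "mat (length vs) (length vs) (\<lambda>(i, j). ip (vs ! i) (ws ! j)) =
      mat (length vs) (length vs) (\<lambda>(i, j). (map ip vs ! i) (ws ! j))"
    by (rule eq_matI) auto
  then show ?thesis
    by (auto simp: wedge_ip_def wedge_def functional_ip)
qed

lemma conjugate_one: "conjugate (1 :: 'k) = 1"
  using mult_conjugate[of "1 :: 'k"] by simp

lemma conjugate_prod: "conjugate (prod (g :: _ \<Rightarrow> 'k) I) = prod (\<lambda>i. conjugate (g i)) I"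
  by (induction I rule: infinite_finite_induct) (auto simp: conjugate_one conjugate_dist_mul)

lemma wedge_ip_commute: "wedge_ip ws vs = conjugate (wedge_ip vs ws)"
proof (cases "length vs = length ws")
  case True
  define n where "n = length vs"
  define M where "M = mat n n (\<lambda>(i, j). ip (vs ! i) (ws ! j))"
  have M: "M \<in> carrier_mat n n" by (simp add: M_def)
  have sg: "conjugate (signof p :: 'k) = signof p" for p :: "nat \<Rightarrow> nat"
    by (auto simp: sign_def conjugate_one conjugate_neg)
  have "mat n n (\<lambda>(i, j). ip (ws ! i) (vs ! j)) = map_mat conjugate (M\<^sup>T)"
    by (rule eq_matI) (auto simp: M_def ip_commute[of "ws ! _"])
  moreover have "det (map_mat conjugate (M\<^sup>T)) = conjugate (det (M\<^sup>T))"
    using M sg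
    by (auto simp: det_def sum_conjugate[OF finite_permutations] conjugate_dist_mul conjugate_prod
        intro!: sum.cong prod.cong arg_cong2[where f = "(*)"])
  ultimately show ?thesis
    using True det_transpose[OF M] by (simp add: wedge_ip_def n_def M_def)
next
  case False
  then show ?thesis by (simp add: wedge_ip_def)
qed

lemma mv_inner_eq:
  assumes "finite S" "finite T"
  shows "mv_inner (\<lambda>\<phi>s. \<Sum>vs\<in>S. a vs * wedge vs \<phi>s) (\<lambda>\<phi>s. \<Sum>ws\<in>T. b ws * wedge ws \<phi>s) =
    (\<Sum>vs\<in>S. \<Sum>ws\<in>T. conjugate (a vs) * b ws * wedge_ip vs ws)"
proof -
  let ?ev = "\<lambda>T b \<phi>s. \<Sum>ws\<in>T. b ws * wedge ws \<phi>s"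
  let ?z = "\<lambda>S a T b. \<Sum>vs\<in>S. \<Sum>ws\<in>T. conjugate (a vs) * b ws * wedge_ip vs ws"
  have right: "?z S a T b = (\<Sum>vs\<in>S. conjugate (a vs) * ?ev T b (map ip vs))" for S a T b
    by (simp add: wedge_ip_eq sum_distrib_left mult.assoc)
  have flip: "?z S a T b = conjugate (?z T b S a)" if "finite S" "finite T" for S a T b
    by (subst sum.swap)
      (simp add: sum_conjugate that conjugate_dist_mul wedge_ip_commute[of _ "_ :: 'x list", symmetric]
        mult.commute mult.left_commute)
  have uniq: "?z S' a' T' b' = ?z S a T b"
    if "finite S'" "finite T'" "?ev S a = ?ev S' a'" "?ev T b = ?ev T' b'" for S' a' T' b'
  proof -
    have "?z S' a' T' b' = ?z S' a' T b"
      by (simp only: right fun_cong[OF that(4)])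
    also have "\<dots> = conjugate (?z T b S' a')"
      by (rule flip) (use assms that in auto)
    also have "\<dots> = conjugate (?z T b S a)"
      by (simp only: right fun_cong[OF that(3)])
    also have "\<dots> = ?z S a T b"
      by (rule flip[symmetric]) (use assms in auto)
    finally show ?thesis .
  qed
  show ?thesis
    unfolding mv_inner_def
  proof (rule the_equality)
    show "\<exists>S' a' T' b'. finite S' \<and> finite T' \<and> ?ev S a = ?ev S' a' \<and> ?ev T b = ?ev T' b' \<and>
        ?z S a T b = ?z S' a' T' b'"
      using assms by blast
  next
    fix z
    assume "\<exists>S' a' T' b'. finite S' \<and> finite T' \<and> ?ev S a = ?ev S' a' \<and> ?ev T b = ?ev T' b' \<and>
        z = ?z S' a' T' b'"
    then obtain S' a' T' b' where "finite S'" "finite T'" "?ev S a = ?ev S' a'"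
      "?ev T b = ?ev T' b'" "z = ?z S' a' T' b'"
      by (elim exE conjE)
    then show "z = ?z S a T b" using uniq by simp
  qed
qed

lemma mv_inner_blades:
  "mv_inner (\<lambda>\<phi>s. c * wedge vs \<phi>s) (\<lambda>\<phi>s. d * wedge ws \<phi>s) = conjugate c * d * wedge_ip vs ws"
  using mv_inner_eq[of "{vs}" "{ws}" "\<lambda>_. c" "\<lambda>_. d"] by simp

lemma wedge_nonzero_iff: "wedge vs \<noteq> (\<lambda>_. 0) \<longleftrightarrow> distinct vs \<and> independent (set vs)"
proof
  define n where "n = length vs"
  assume nz: "wedge vs \<noteq> (\<lambda>_. 0)"
  then obtain \<phi>s where "wedge vs \<phi>s \<noteq> 0" by auto
  then have len: "length \<phi>s = n" and lin: "\<And>\<phi>. \<phi> \<in> set \<phi>s \<Longrightarrow> functional \<phi>"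
    and det: "det (mat n n (\<lambda>(i, j). (\<phi>s ! i) (vs ! j))) \<noteq> 0"
    by (auto simp: wedge_def n_def split: if_splits)
  define M where "M = mat n n (\<lambda>(i, j). (\<phi>s ! i) (vs ! j))"
  have M: "M \<in> carrier_mat n n" by (simp add: M_def)
  have inj: "c k = 0" if "(\<Sum>j<n. c j *s vs ! j) = 0" "k < n" for c k
  proof -
    have "M *\<^sub>v vec n c = 0\<^sub>v n"
    proof (rule eq_vecI)
      fix i assume "i < dim_vec (0\<^sub>v n :: 'k vec)"
      then have i: "i < n" by simp
      then have f: "functional (\<phi>s ! i)" using lin len by auto
      have "(\<phi>s ! i) 0 = 0" using functional_sum[OF f, of _ _ "{}"] by simp
      then have "(\<Sum>j<n. c j * (\<phi>s ! i) (vs ! j)) = 0"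
        using functional_sum[OF f, of c "(!) vs" "{..<n}"] that(1) by simp
      then show "(M *\<^sub>v vec n c) $ i = 0\<^sub>v n $ i"
        using i by (simp add: M_def scalar_prod_def atLeast0LessThan mult.commute)
    qed (use M in auto)
    then have "vec n c = 0\<^sub>v n"
      using det det_0_iff_vec_prod_zero_field[OF M] unfolding M_def[symmetric]
      by (metis vec_carrier)
    then show ?thesis using that(2) by (metis index_vec index_zero_vec(1))
  qed
  have d: "distinct vs"
  proof (rule ccontr)
    assume "\<not> distinct vs"
    then obtain i j where ij: "i < n" "j < n" "i \<noteq> j" "vs ! i = vs ! j"
      by (auto simp: distinct_conv_nth n_def)
    define c :: "nat \<Rightarrow> 'k" where "c = (\<lambda>k. if k = i then 1 else if k = j then - 1 else 0)"
    have "(\<Sum>k<n. c k *s vs ! k) = (\<Sum>k\<in>{i, j}. c k *s vs ! k)"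
      by (rule sum.mono_neutral_right) (use ij in \<open>auto simp: c_def\<close>)
    also have "\<dots> = 0" using ij by (simp add: c_def)
    finally show False using inj[of c i] ij by (simp add: c_def)
  qed
  have "independent (set vs)"
  proof
    assume "dependent (set vs)"
    then obtain u v where u: "(\<Sum>v\<in>set vs. u v *s v) = 0" "v \<in> set vs" "u v \<noteq> 0"
      using dependent_finite[of "set vs"] by auto
    have "(\<Sum>k<n. u (vs ! k) *s vs ! k) = (\<Sum>v\<in>set vs. u v *s v)"
      by (rule sum.reindex_bij_betw[OF bij_betw_nth]) (use d in \<open>auto simp: n_def\<close>)
    then show False using inj[of "\<lambda>k. u (vs ! k)"] u by (auto simp: in_set_conv_nth n_def)
  qed
  with d show "distinct vs \<and> independent (set vs)" by simp
next
  assume *: "distinct vs \<and> independent (set vs)"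
  define n where "n = length vs"
  interpret vsp: vector_space_pair scale "(*) :: 'k \<Rightarrow> 'k \<Rightarrow> 'k"
    by (auto simp: vector_space_pair_def vector_space_axioms vector_space_def algebra_simps)
  have "\<exists>\<phi>. functional \<phi> \<and> (\<forall>w\<in>set vs. \<phi> w = (if w = v then 1 else 0))" for v
    unfolding functional_def
    using vsp.linear_independent_extend[of "set vs" "\<lambda>w. if w = v then 1 else 0"] * by auto
  then obtain \<Phi> where \<Phi>: "\<And>v. functional (\<Phi> v)"
    "\<And>v w. w \<in> set vs \<Longrightarrow> \<Phi> v w = (if w = v then 1 else 0)"
    by metis
  have "mat n n (\<lambda>(i, j). (map \<Phi> vs ! i) (vs ! j)) = 1\<^sub>m n"
    by (rule eq_matI) (use \<Phi>(2) * in \<open>auto simp: n_def nth_eq_iff_index_eq\<close>)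
  then have "wedge vs (map \<Phi> vs) = 1"
    using \<Phi>(1) by (simp add: wedge_def n_def)
  then show "wedge vs \<noteq> (\<lambda>_. 0)" by (metis zero_neq_one)
qed

end

end

theory Submission
  imports Defs
begin

text \<open>Since the orthogonal projection \<open>P\<close> maps \<open>V\<close> into \<open>W\<close>, the blade \<open>Pv\<^sub>1 \<and> \<dots> \<and> Pv\<^sub>p\<close> is a
  multiple \<open>k w\<^sub>1 \<and> \<dots> \<and> w\<^sub>p\<close>. As \<open>\<langle>w\<^sub>i, v\<^sub>j\<rangle> = \<langle>w\<^sub>i, Pv\<^sub>j\<rangle>\<close>, pairing it with \<open>w\<^sub>1 \<and> \<dots> \<and> w\<^sub>p\<close>
  gives \<open>det B = k det A\<close>, while its squared norm is \<open>\<bar>k\<bar>\<^sup>2 det A\<close>, that is, \<open>\<bar>det B\<bar>\<^sup>2 / det A\<close>.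
  For the angle to exist, the quotient of the norms must be independent of the blade, which holds
  as blades representing \<open>V\<close> are proportional, and at most \<open>1\<close>, which holds as a linear
  contraction does not increase Gram determinants.\<close>

lemma conjugate_mult_self: "conjugate a * a = of_real ((norm a)\<^sup>2)" for a :: "'k::rc_field"
  using mult_conjugate[of a] by (simp add: scaleR_conv_of_real mult.commute)

context fd_inner_product_space
begin

section \<open>Real and complex inner products\<close>

lemma ip_add_left: "ip (x + y) z = ip x z + ip y z"
  by (metis ip_commute ip_add_right conjugate_dist_add)

lemma ip_scale_left: "ip (c *s x) z = conjugate c * ip x z"
  by (metis ip_commute ip_scale_right conjugate_dist_mul)

lemma ip_zero_right [simp]: "ip x 0 = 0"
  using ip_add_right[of x 0 0] by simp

lemma ip_zero_left [simp]: "ip 0 x = 0"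
  using ip_add_left[of 0 0 x] by simp

lemma ip_diff_right: "ip x (y - z) = ip x y - ip x z"
  using ip_add_right[of x "y - z" z] by simp

lemma ip_diff_left: "ip (x - y) z = ip x z - ip y z"
  using ip_add_left[of "x - y" y z] by simp

lemma ip_eq_0_commute: "ip x y = 0 \<longleftrightarrow> ip y x = 0"
  using ip_commute[of x y] ip_commute[of y x] by auto

text \<open>\<open>ip x x\<close> is a nonnegative real lying in the scalar type;
  \<open>norm\<close> extracts it as a \<open>real\<close>, so that lengths can be compared.\<close>

definition sqnorm :: "'x \<Rightarrow> real" where
  "sqnorm x = norm (ip x x)"

lemma sqnorm_nonneg: "0 \<le> sqnorm x"
  by (simp add: sqnorm_def)

lemma sqnorm_pos: "x \<noteq> 0 \<Longrightarrow> 0 < sqnorm x"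
  using ip_pos[of x] by (auto simp: sqnorm_def)

lemma ip_self: "ip x x = of_real (sqnorm x)"
  using ip_pos[of x] by (cases "x = 0") (auto simp: sqnorm_def)

lemma ip_self_eq_0_iff: "ip x x = 0 \<longleftrightarrow> x = 0"
  using sqnorm_pos[of x] by (cases "x = 0") (auto simp: sqnorm_def)

text \<open>Pythagoras, computed among the scalars and pulled back to the reals by injectivity of
  \<open>of_real\<close>.\<close>

lemma sqnorm_add_orthogonal:
  assumes "ip x y = 0"
  shows "sqnorm (x + y) = sqnorm x + sqnorm y"
proof -
  have "(of_real (sqnorm (x + y)) :: 'k) = of_real (sqnorm x + sqnorm y)"
    using assms ip_eq_0_commute[of x y]
    by (simp add: ip_self[symmetric] ip_add_left ip_add_right)
  then show ?thesis by (simp only: of_real_eq_iff)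
qed

section \<open>Orthogonal projection onto the span of a finite set\<close>

lemma subspace_orthogonal: "subspace {w. ip w z = 0}"
  by (rule subspaceI) (auto simp: ip_add_left ip_scale_left)

lemma orthogonal_span:
  assumes "\<And>w. w \<in> S \<Longrightarrow> ip w z = 0" "w \<in> span S"
  shows "ip w z = 0"
  using span_minimal[OF _ subspace_orthogonal, of S z] assms by blast

text \<open>Gram-Schmidt without normalization. The induction hypothesis serves both
  \<open>x\<close> and the new generator, hence \<open>x\<close> is arbitrary.\<close>

lemma ex_orthogonal_projection:
  assumes "finite S"
  shows "\<exists>y\<in>span S. \<forall>w\<in>span S. ip w (x - y) = 0"
  using assms
proof (induction S arbitrary: x)
  case empty
  then show ?case by simp
next
  case (insert a S)
  obtain y where y: "y \<in> span S" "\<And>w. w \<in> span S \<Longrightarrow> ip w (x - y) = 0"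
    using insert.IH by blast
  obtain b where b: "b \<in> span S" "\<And>w. w \<in> span S \<Longrightarrow> ip w (a - b) = 0"
    using insert.IH by blast
  \<comment> \<open>\<open>a'\<close> is the part of \<open>a\<close> orthogonal to
    \<open>span S\<close>; \<open>z\<close> adds to \<open>y\<close> the component of
    \<open>x\<close> along it.\<close>
  define a' where "a' = a - b"
  define z where "z = y + (ip a' x / ip a' a') *s a'"
  have mono: "span S \<subseteq> span (insert a S)"
    by (rule span_mono) auto
  have "a' \<in> span (insert a S)"
    unfolding a'_def using b(1) mono by (blast intro: span_diff span_base)
  then have z: "z \<in> span (insert a S)"
    unfolding z_def using y(1) mono by (auto intro!: span_add span_scale)
  have S: "ip w (x - z) = 0" if "w \<in> span S" for w
    using y(2)[OF that] b(2)[OF that]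
    by (simp add: z_def a'_def ip_add_right ip_diff_right ip_scale_right)
  have "ip a' y = 0"
    using b(2)[OF y(1)] ip_eq_0_commute by (simp add: a'_def)
  \<comment> \<open>The case \<open>a' = 0\<close>, where \<open>z\<close> contains a division by
    zero, is trivial.\<close>
  then have "ip a' (x - z) = 0"
    by (cases "a' = 0")
      (simp_all add: z_def ip_add_right ip_diff_right ip_scale_right ip_self_eq_0_iff)
  then have "ip a (x - z) = 0"
    using S[OF b(1)] by (simp add: a'_def ip_diff_left)
  then have "ip w (x - z) = 0" if "w \<in> span (insert a S)" for w
    using orthogonal_span[OF _ that] S span_base by blast
  with z show ?case by blast
qed

text \<open>The difference of two candidates lies in \<open>W\<close> and is orthogonal to
  itself.\<close>

lemma proj_unique:
  assumes "subspace W" "y \<in> W" "\<And>w. w \<in> W \<Longrightarrow> ip w (x - y) = 0"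
  shows "proj W x = y"
  unfolding proj_def
proof (rule the_equality)
  fix y'
  assume y': "y' \<in> W \<and> (\<forall>w\<in>W. ip w (x - y') = 0)"
  have "y' - y \<in> W"
    using assms(1,2) y' by (simp add: subspace_diff)
  then have "ip (y' - y) (y' - y) = 0"
    using assms(3)[of "y' - y"] y' by (auto simp: ip_diff_right)
  then show "y' = y" by (simp add: ip_self_eq_0_iff)
qed (use assms in auto)

lemma proj_span:
  assumes "finite S"
  shows proj_in_span: "proj (span S) x \<in> span S"
    and proj_orthogonal: "w \<in> span S \<Longrightarrow> ip w (x - proj (span S) x) = 0"
proof -
  obtain y where "y \<in> span S" "\<And>w. w \<in> span S \<Longrightarrow> ip w (x - y) = 0"
    using ex_orthogonal_projection[OF assms] by blast
  with proj_unique[of "span S" y x]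
  show "proj (span S) x \<in> span S" "w \<in> span S \<Longrightarrow> ip w (x - proj (span S) x) = 0"
    by auto
qed

text \<open>By uniqueness, it suffices that sums and multiples of projections satisfy the
  characterization of the projection.\<close>

lemma linear_proj_span:
  assumes "finite S"
  shows "Vector_Spaces.linear scale scale (proj (span S))"
proof (rule Vector_Spaces.linear_iff[THEN iffD2], intro conjI allI)
  fix x y c
  note P = proj_span[OF assms]
  show "proj (span S) (x + y) = proj (span S) x + proj (span S) y"
  proof (rule proj_unique)
    fix w assume "w \<in> span S"
    then have "ip w (x - proj (span S) x) + ip w (y - proj (span S) y) = 0"
      using P(2) by simp
    then show "ip w (x + y - (proj (span S) x + proj (span S) y)) = 0"
      by (simp add: ip_add_right ip_diff_right algebra_simps)
  qed (auto simp: P span_add)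
  show "proj (span S) (c *s x) = c *s proj (span S) x"
  proof (rule proj_unique)
    fix w assume "w \<in> span S"
    then show "ip w (c *s x - c *s proj (span S) x) = 0"
      using P(2)[of w x] by (simp add: ip_scale_right ip_diff_right algebra_simps)
  qed (auto simp: P span_scale)
qed (simp_all add: vector_space_axioms)

lemma sqnorm_proj_le:
  assumes "finite S"
  shows "sqnorm (proj (span S) x) \<le> sqnorm x"
proof -
  have "sqnorm (proj (span S) x + (x - proj (span S) x)) =
      sqnorm (proj (span S) x) + sqnorm (x - proj (span S) x)"
    by (rule sqnorm_add_orthogonal) (simp add: proj_span[OF assms])
  then show ?thesis using sqnorm_nonneg[of "x - proj (span S) x"] by simp
qed

text \<open>Pythagoras again: \<open>x - s\<close> splits into a vector of the span and the
  orthogonal remainder \<open>x - proj (span S) x\<close>.\<close>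

lemma sqnorm_diff_proj_le:
  assumes "finite S" "s \<in> span S"
  shows "sqnorm (x - proj (span S) x) \<le> sqnorm (x - s)"
proof -
  have "ip (proj (span S) x - s) (x - proj (span S) x) = 0"
    using assms by (intro proj_orthogonal) (auto intro: span_diff proj_in_span)
  from sqnorm_add_orthogonal[OF this] show ?thesis
    using sqnorm_nonneg[of "proj (span S) x - s"] by simp
qed

section \<open>Wedge products of linear combinations\<close>

text \<open>Coefficients are indexed by list positions instead of vectors, because they are to
  become matrix entries.\<close>

lemma in_span_set_nth:
  assumes "u \<in> span (set vs)"
  shows "\<exists>c. u = (\<Sum>k<length vs. c k *s vs ! k)"
proof -
  let ?L = "{u. \<exists>c. u = (\<Sum>k<length vs. c k *s vs ! k)}"
  have "subspace ?L"
  proof (rule subspaceI)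
    show "0 \<in> ?L" by (auto intro!: exI[of _ "\<lambda>_. 0"])
  next
    fix x y assume "x \<in> ?L" "y \<in> ?L"
    then obtain c d where "x = (\<Sum>k<length vs. c k *s vs ! k)" "y = (\<Sum>k<length vs. d k *s vs ! k)"
      by blast
    then have "x + y = (\<Sum>k<length vs. (c k + d k) *s vs ! k)"
      by (simp add: scale_left_distrib sum.distrib)
    then show "x + y \<in> ?L" by (auto intro!: exI[of _ "\<lambda>k. c k + d k"])
  next
    fix a x assume "x \<in> ?L"
    then obtain c where "x = (\<Sum>k<length vs. c k *s vs ! k)"
      by blast
    then have "a *s x = (\<Sum>k<length vs. (a * c k) *s vs ! k)"
      by (simp add: scale_sum_right)
    then show "a *s x \<in> ?L" by (auto intro!: exI[of _ "\<lambda>k. a * c k"])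
  qed
  moreover have "set vs \<subseteq> ?L"
  proof
    fix v assume "v \<in> set vs"
    then obtain i where i: "i < length vs" "v = vs ! i"
      by (auto simp: in_set_conv_nth)
    have "v = (\<Sum>k<length vs. if k = i then vs ! k else 0)"
      using i by simp
    also have "\<dots> = (\<Sum>k<length vs. (if k = i then 1 else 0) *s vs ! k)"
      by (intro sum.cong) auto
    finally show "v \<in> ?L" by (auto intro!: exI[of _ "\<lambda>k. if k = i then 1 else 0"])
  qed
  ultimately have "span (set vs) \<subseteq> ?L" by (rule span_minimal[rotated])
  with assms show ?thesis by blast
qed

text \<open>The matrix of values of \<open>\<phi>s\<close> on \<open>us\<close> is the one on
  \<open>vs\<close> times the coefficient matrix, and determinants are multiplicative.\<close>

lemma wedge_lincomb:
  assumes "length us = length vs"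
    and "\<And>j. j < length vs \<Longrightarrow> us ! j = (\<Sum>k<length vs. c k j *s vs ! k)"
  shows "wedge us \<phi>s = det (mat (length vs) (length vs) (\<lambda>(k, j). c k j)) * wedge vs \<phi>s"
proof (cases "length \<phi>s = length vs \<and> (\<forall>\<phi>\<in>set \<phi>s. functional \<phi>)")
  case True
  define n where "n = length vs"
  define M where "M = mat n n (\<lambda>(k, j). c k j)"
  define N where "N = mat n n (\<lambda>(i, j). (\<phi>s ! i) (vs ! j))"
  have carr: "M \<in> carrier_mat n n" "N \<in> carrier_mat n n" by (auto simp: M_def N_def)
  have "mat n n (\<lambda>(i, j). (\<phi>s ! i) (us ! j)) = N * M"
  proof (rule eq_matI)
    fix i j assume "i < dim_row (N * M)" "j < dim_col (N * M)"
    then have ij: "i < n" "j < n" using carr by auto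
    then have "functional (\<phi>s ! i)" using True n_def by auto
    then have "(\<phi>s ! i) (us ! j) = (\<Sum>k<n. c k j * (\<phi>s ! i) (vs ! k))"
      using assms(2)[of j] ij functional_sum[of "\<phi>s ! i"] by (simp add: n_def)
    then show "mat n n (\<lambda>(i, j). (\<phi>s ! i) (us ! j)) $$ (i, j) = (N * M) $$ (i, j)"
      using ij by (simp add: M_def N_def scalar_prod_def atLeast0LessThan mult.commute)
  qed (use carr in auto)
  then show ?thesis
    using True assms(1) det_mult[OF carr(2,1)]
    by (simp add: wedge_def n_def M_def N_def mult.commute)
next
  case False
  then show ?thesis using assms(1) by (auto simp: wedge_def)
qed

lemma wedge_subset_span:
  assumes "length us = length vs" "set us \<subseteq> span (set vs)"
  shows "\<exists>k. \<forall>\<phi>s. wedge us \<phi>s = k * wedge vs \<phi>s"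
proof -
  have "\<forall>j. \<exists>c. j < length vs \<longrightarrow> us ! j = (\<Sum>k<length vs. c k *s vs ! k)"
    using assms in_span_set_nth by (metis nth_mem subset_iff)
  then obtain c where "\<And>j. j < length vs \<Longrightarrow> us ! j = (\<Sum>k<length vs. c j k *s vs ! k)"
    by metis
  from wedge_lincomb[OF assms(1), of "\<lambda>k j. c j k"] this show ?thesis by blast
qed

text \<open>The change of vectors is a shear: its coefficient matrix is upper triangular with unit
  diagonal.\<close>

lemma wedge_snoc_diff_span:
  assumes "s \<in> span (set us)"
  shows "wedge (us @ [x - s]) = wedge (us @ [x])"
proof
  fix \<phi>s
  define n where "n = length us"
  obtain d where d: "s = (\<Sum>k<n. d k *s us ! k)"
    using in_span_set_nth[OF assms] n_def by blast
  \<comment> \<open>Columns \<open>j < n\<close> are unit vectors; the last one,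
    \<open>j = n\<close>, holds the coefficients of \<open>x - s\<close> with respect to
    \<open>us @ [x]\<close>.\<close>
  define c where "c k j = (if j < n then if k = j then 1 else 0 else if k = n then 1 else - d k)"
    for k j
  define M where "M = mat (Suc n) (Suc n) (\<lambda>(k, j). c k j)"
  have "wedge (us @ [x - s]) \<phi>s = det (mat (length (us @ [x])) (length (us @ [x])) (\<lambda>(k, j). c k j)) *
      wedge (us @ [x]) \<phi>s"
  proof (rule wedge_lincomb)
    fix j assume "j < length (us @ [x])"
    then consider "j < n" | "j = n" by (auto simp: n_def less_Suc_eq)
    then show "(us @ [x - s]) ! j = (\<Sum>k<length (us @ [x]). c k j *s (us @ [x]) ! k)"
    proof cases
      case 1
      have "(\<Sum>k<n. c k j *s (us @ [x]) ! k) = (\<Sum>k<n. if k = j then us ! k else 0)"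
        using 1 by (intro sum.cong) (auto simp: c_def nth_append n_def)
      then show ?thesis using 1 by (simp add: nth_append n_def[symmetric] c_def)
    next
      case 2
      have "(\<Sum>k<n. c k j *s (us @ [x]) ! k) = (\<Sum>k<n. - (d k *s us ! k))"
        using 2 by (intro sum.cong) (auto simp: c_def nth_append n_def)
      also have "\<dots> = - s" by (simp add: d sum_negf)
      finally show ?thesis using 2 by (simp add: nth_append n_def[symmetric] c_def)
    qed
  qed simp
  also have "mat (length (us @ [x])) (length (us @ [x])) (\<lambda>(k, j). c k j) = M"
    by (simp add: M_def n_def)
  also have "det M = prod_list (diag_mat M)"
    by (rule det_upper_triangular[of _ "Suc n"]) (auto simp: M_def c_def)
  also have "\<dots> = 1"
    unfolding prod_list_diag_prod by (rule prod.neutral) (auto simp: M_def c_def)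
  finally show "wedge (us @ [x - s]) \<phi>s = wedge (us @ [x]) \<phi>s" by simp
qed

section \<open>Gram determinants\<close>

abbreviation gram :: "'x list \<Rightarrow> 'k" where
  "gram vs \<equiv> wedge_ip vs vs"

text \<open>\<open>gram us\<close> is the inner product of \<open>wedge us\<close> with itself. As
  \<open>mv_inner\<close> is well defined, it depends on \<open>us\<close> only through that
  form.\<close>

lemma gram_wedge_scaled:
  assumes "\<And>\<phi>s. wedge us \<phi>s = k * wedge vs \<phi>s"
  shows "gram us = of_real ((norm k)\<^sup>2) * gram vs"
proof -
  have "gram us = mv_inner (\<lambda>\<phi>s. 1 * wedge us \<phi>s) (\<lambda>\<phi>s. 1 * wedge us \<phi>s)"
    by (simp add: mv_inner_blades conjugate_one del: mult_1)
  also have "\<dots> = gram vs * (conjugate k * k)"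
    by (simp add: assms mv_inner_blades)
  finally show ?thesis by (simp add: conjugate_mult_self)
qed

text \<open>Orthogonality makes the Gram matrix block diagonal.\<close>

lemma gram_snoc_orthogonal:
  assumes "\<And>u. u \<in> set us \<Longrightarrow> ip u y = 0"
  shows "gram (us @ [y]) = gram us * ip y y"
proof -
  define n where "n = length us"
  define G where "G = mat n n (\<lambda>(i, j). ip (us ! i) (us ! j))"
  have "mat (Suc n) (Suc n) (\<lambda>(i, j). ip ((us @ [y]) ! i) ((us @ [y]) ! j)) =
      four_block_mat G (0\<^sub>m n 1) (0\<^sub>m 1 n) (mat 1 1 (\<lambda>_. ip y y))"
    using assms ip_eq_0_commute[of y]
    by (intro eq_matI) (auto simp: four_block_mat_def G_def nth_append n_def Let_def less_Suc_eq)
  moreover have "det (four_block_mat G (0\<^sub>m n 1) (0\<^sub>m 1 n) (mat 1 1 (\<lambda>_. ip y y))) =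
      det G * det (mat 1 1 (\<lambda>_. ip y y))"
    by (rule det_four_block_mat_lower_left_zero) (auto simp: G_def)
  moreover have "det (mat 1 1 (\<lambda>_. ip y y)) = ip y y"
    by (simp add: det_single)
  ultimately show ?thesis by (simp add: wedge_ip_def n_def G_def)
qed

text \<open>Subtracting the projection from \<open>x\<close> keeps the wedge, hence the Gram
  determinant, and makes the last vector orthogonal to the others.\<close>

lemma gram_snoc:
  "gram (us @ [x]) = gram us * of_real (sqnorm (x - proj (span (set us)) x))"
proof -
  let ?y = "x - proj (span (set us)) x"
  have "wedge (us @ [x]) \<phi>s = 1 * wedge (us @ [?y]) \<phi>s" for \<phi>s
    by (simp add: wedge_snoc_diff_span proj_in_span)
  then have "gram (us @ [x]) = gram (us @ [?y])"
    using gram_wedge_scaled[of "us @ [x]" 1 "us @ [?y]"] by simp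
  also have "\<dots> = gram us * ip ?y ?y"
    by (rule gram_snoc_orthogonal) (simp add: proj_orthogonal span_base)
  finally show ?thesis by (simp add: ip_self)
qed

lemma gram_Nil: "gram [] = 1"
  by (simp add: wedge_ip_def det_dim_zero)

text \<open>By \<open>gram_snoc\<close>, a Gram determinant is a product of squared distances. The
  equation serves to pass between scalars and reals.\<close>

lemma gram_eq_norm: "gram us = of_real (norm (gram us))"
proof (induction us rule: rev_induct)
  case (snoc x us)
  have "gram (us @ [x]) = of_real (norm (gram us)) * of_real (sqnorm (x - proj (span (set us)) x))"
    by (subst gram_snoc, subst snoc.IH) (rule refl)
  then show ?case
    by (simp add: norm_mult sqnorm_nonneg)
qed (simp add: gram_Nil)

lemma norm_gram_snoc:
  "norm (gram (us @ [x])) = norm (gram us) * sqnorm (x - proj (span (set us)) x)"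
  by (simp add: gram_snoc norm_mult sqnorm_nonneg)

text \<open>By independence, each vector has positive distance from the span of its
  predecessors.\<close>

lemma gram_nonzero:
  assumes "distinct us" "independent (set us)"
  shows "gram us \<noteq> 0"
  using assms
proof (induction us rule: rev_induct)
  case (snoc x us)
  then have "x \<notin> span (set us)" "independent (set us)"
    by (auto simp: independent_insert)
  then have "x - proj (span (set us)) x \<noteq> 0"
    using proj_in_span[of "set us" x] by auto
  from sqnorm_pos[OF this] show ?case
    using snoc \<open>independent (set us)\<close> by (simp add: gram_snoc)
qed (simp add: gram_Nil)

text \<open>Adding a vector multiplies the Gram determinant by the squared distance to the span of the
  previous vectors, and a linear contraction does not increase this distance.\<close>

lemma gram_map_contraction_le:
  assumes lin: "Vector_Spaces.linear scale scale f"
    and contr: "\<And>x. sqnorm (f x) \<le> sqnorm x"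
  shows "norm (gram (map f us)) \<le> norm (gram us)"
proof (induction us rule: rev_induct)
  case (snoc x us)
  interpret f: Vector_Spaces.linear scale scale f by (rule lin)
  let ?q = "proj (span (set us)) x" and ?q' = "proj (span (set (map f us))) (f x)"
  \<comment> \<open>\<open>f ?q\<close> competes with \<open>?q'\<close> for the point of the image
    span nearest to \<open>f x\<close>.\<close>
  have "f ?q \<in> span (set (map f us))"
    using proj_in_span[of "set us" x] by (simp add: f.span_image)
  then have "sqnorm (f x - ?q') \<le> sqnorm (f x - f ?q)"
    by (intro sqnorm_diff_proj_le) auto
  also have "\<dots> = sqnorm (f (x - ?q))" by (simp add: f.diff)
  also have "\<dots> \<le> sqnorm (x - ?q)" by (rule contr)
  finally have "norm (gram (map f us)) * sqnorm (f x - ?q') \<le> norm (gram us) * sqnorm (x - ?q)"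
    using snoc.IH by (intro mult_mono) (auto simp: sqnorm_nonneg)
  then show ?case using norm_gram_snoc[of "map f us" "f x"] norm_gram_snoc[of us x] by simp
qed simp

section \<open>Norms of blades and the Grassmann angle\<close>

lemma mv_norm_blade: "mv_norm (\<lambda>\<phi>s. c * wedge vs \<phi>s) = norm c * sqrt (norm (gram vs))"
proof -
  have "norm (conjugate c * c) = (norm c)\<^sup>2"
    unfolding conjugate_mult_self norm_of_real by simp
  then show ?thesis
    by (simp add: mv_norm_def mv_inner_blades norm_mult[of "conjugate c * c"] real_sqrt_mult)
qed

text \<open>The factors of a nonzero blade for \<open>V\<close> form a basis of \<open>V\<close>, so
  they are as many as \<open>vs\<close>, and the two wedges are proportional.\<close>

lemma represents_ordered_basis:
  assumes "ordered_basis vs V" "represents \<nu> V"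
  shows "\<exists>c. c \<noteq> 0 \<and> \<nu> = (\<lambda>\<phi>s. c * wedge vs \<phi>s)"
proof -
  obtain c us where \<nu>: "\<nu> \<noteq> (\<lambda>_. 0)" "\<nu> = (\<lambda>\<phi>s. c * wedge us \<phi>s)" "V = span (set us)"
    using assms(2) by (auto simp: represents_def)
  then have "wedge us \<noteq> (\<lambda>_. 0)" by auto
  then have us: "distinct us" "independent (set us)" by (auto simp: wedge_nonzero_iff)
  have vs: "distinct vs" "independent (set vs)" "span (set vs) = V"
    using assms(1) by (auto simp: ordered_basis_def)
  have "card (set us) = card (set vs)"
    using dim_eq_card[of "set us" "set us"] dim_eq_card[of "set vs" "set us"] us vs \<nu>(3) by simp
  then have "length us = length vs"
    using us vs by (simp add: distinct_card)
  moreover have "set us \<subseteq> span (set vs)" using vs \<nu>(3) span_superset by blast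
  ultimately obtain k where "\<And>\<phi>s. wedge us \<phi>s = k * wedge vs \<phi>s"
    using wedge_subset_span by blast
  then have "\<nu> = (\<lambda>\<phi>s. (c * k) * wedge vs \<phi>s)" using \<nu>(2) by (simp add: mult.assoc)
  moreover from this \<nu>(1) have "c * k \<noteq> 0" by auto
  ultimately show ?thesis by blast
qed

text \<open>Reduces the angle to a single basis: its defining description has the unique solution
  \<open>arccos r\<close>.\<close>

lemma cos_grassmann_angle:
  assumes vs: "ordered_basis vs V" and fin: "finite S"
  shows "cos (grassmann_angle V (span S)) =
    sqrt (norm (gram (map (proj (span S)) vs)) / norm (gram vs))"
proof -
  define r where "r = sqrt (norm (gram (map (proj (span S)) vs)) / norm (gram vs))"
  have vs': "distinct vs" "independent (set vs)" "span (set vs) = V"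
    using vs by (auto simp: ordered_basis_def)
  have ratio: "mv_norm (mv_map (proj (span S)) \<nu>) / mv_norm \<nu> = r" if rep: "represents \<nu> V" for \<nu>
  proof -
    obtain c where "c \<noteq> 0" "\<nu> = (\<lambda>\<phi>s. c * wedge vs \<phi>s)"
      using represents_ordered_basis[OF vs rep] by blast
    then show ?thesis
      by (simp add: mv_map_wedge[OF linear_proj_span[OF fin]] mv_norm_blade real_sqrt_divide r_def)
  qed
  \<comment> \<open>A blade representing \<open>V\<close> has to exist: otherwise every \<theta> in
    range would meet the condition vacuously.\<close>
  have "wedge vs \<noteq> (\<lambda>_. 0)" using vs' by (simp add: wedge_nonzero_iff)
  moreover have "wedge vs = (\<lambda>\<phi>s. 1 * wedge vs \<phi>s)" by simp
  ultimately have rep: "represents (wedge vs) V"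
    using vs' unfolding represents_def by blast
  have "norm (gram (map (proj (span S)) vs)) \<le> norm (gram vs)"
    by (rule gram_map_contraction_le[OF linear_proj_span[OF fin] sqnorm_proj_le[OF fin]])
  then have r: "0 \<le> r" "r \<le> 1"
    by (auto simp: r_def divide_le_eq_1)
  have "grassmann_angle V (span S) = arccos r"
    unfolding grassmann_angle_def
  proof (rule the_equality)
    show "0 \<le> arccos r \<and> arccos r \<le> pi / 2 \<and> (\<forall>\<nu>. represents \<nu> V \<longrightarrow>
        cos (arccos r) = mv_norm (mv_map (proj (span S)) \<nu>) / mv_norm \<nu>)"
      using r ratio arccos_le_pi2[of r] by (auto simp: arccos_lbound)
  next
    fix \<theta>
    assume "0 \<le> \<theta> \<and> \<theta> \<le> pi / 2 \<and> (\<forall>\<nu>. represents \<nu> V \<longrightarrow>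
        cos \<theta> = mv_norm (mv_map (proj (span S)) \<nu>) / mv_norm \<nu>)"
    then have "0 \<le> \<theta>" "\<theta> \<le> pi" "cos \<theta> = r" using rep ratio by auto
    then show "\<theta> = arccos r" using arccos_cos by force
  qed
  then have "cos (grassmann_angle V (span S)) = r" using r by simp
  then show ?thesis by (simp only: r_def)
qed

section \<open>Gram determinant of a projected basis\<close>

text \<open>With \<open>k\<close> the factor between the two wedges, both sides are the square of
  \<open>norm k\<close> times the square of \<open>gram ws\<close>.\<close>

lemma gram_proj_eq:
  assumes ws: "distinct ws" "independent (set ws)" and len: "length vs = length ws"
  shows "gram (map (proj (span (set ws))) vs) * gram ws = of_real ((norm (wedge_ip ws vs))\<^sup>2)"
proof -
  let ?us = "map (proj (span (set ws))) vs"
  have "set ?us \<subseteq> span (set ws)" by (auto intro: proj_in_span)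
  then obtain k where k: "\<And>\<phi>s. wedge ?us \<phi>s = k * wedge ws \<phi>s"
    using wedge_subset_span[of ?us ws] len by auto
  have "ip w (proj (span (set ws)) v) = ip w v" if "w \<in> set ws" for w v
    using proj_orthogonal[of "set ws" w v] span_base[OF that] by (simp add: ip_diff_right)
  then have "wedge_ip ws vs = wedge_ip ws ?us"
    using len by (auto simp: wedge_ip_def intro!: arg_cong[where f = det] cong_mat)
  \<comment> \<open>\<open>wedge_ip ws\<close> evaluates a wedge at the functionals
    \<open>ip w\<close>, so proportionality of wedges carries over to it.\<close>
  also have "\<dots> = k * gram ws" by (simp only: wedge_ip_eq k)
  finally have "(norm (wedge_ip ws vs))\<^sup>2 = (norm k)\<^sup>2 * (norm (gram ws) * norm (gram ws))"
    by (simp add: norm_mult power2_eq_square)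
  then show ?thesis
    unfolding gram_wedge_scaled[OF k]
    by (simp add: gram_eq_norm[symmetric])
qed

end

theorem theorem3p1:
  fixes scale :: "'k::rc_field \<Rightarrow> 'x::ab_group_add \<Rightarrow> 'x"
    and Basis V W :: "'x set"
    and ip :: "'x \<Rightarrow> 'x \<Rightarrow> 'k"
    and vs ws :: "'x list"
    and p :: nat
    and A B D :: "'k mat"
  assumes "fd_inner_product_space scale Basis ip"
    and "length vs = p" and "fd_inner_product_space.ordered_basis scale vs V"
    and "length ws = p" and "fd_inner_product_space.ordered_basis scale ws W"
    and "A = mat p p (\<lambda>(i, j). ip (ws ! i) (ws ! j))"
    and "B = mat p p (\<lambda>(i, j). ip (ws ! i) (vs ! j))"
    and "D = mat p p (\<lambda>(i, j). ip (vs ! i) (vs ! j))"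
  shows "of_real ((cos (fd_inner_product_space.grassmann_angle scale ip V W))\<^sup>2) =
    of_real ((norm (det B))\<^sup>2) / (det A * det D)"
proof -
  interpret fd_inner_product_space scale Basis ip by (rule assms(1))
  have det: "det A = gram ws" "det B = wedge_ip ws vs" "det D = gram vs"
    using assms by (simp_all add: wedge_ip_def)
  have ws: "distinct ws" "independent (set ws)" "W = span (set ws)"
    using assms(5) by (auto simp: ordered_basis_def)
  let ?us = "map (proj W) vs"
  have "of_real ((cos (grassmann_angle V W))\<^sup>2) = gram ?us / gram vs"
    unfolding ws(3) cos_grassmann_angle[OF assms(3) finite_set]
    by (simp add: gram_eq_norm[symmetric])
  \<comment> \<open>Expanding by the nonzero \<open>gram ws\<close> produces the numerator computed
    in \<open>gram_proj_eq\<close>.\<close>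
  also have "\<dots> = (gram ?us * gram ws) / (gram ws * gram vs)"
    using gram_nonzero[OF ws(1,2)] by simp
  also have "gram ?us * gram ws = of_real ((norm (det B))\<^sup>2)"
    unfolding det ws(3) using gram_proj_eq[OF ws(1,2)] assms(2,4) by simp
  finally show ?thesis unfolding det .
qed

end
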